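(* Let $X$ be a partially ordered vector space with positive cone $X_+$, and let $\tau_o\text{-int}(X_+)$ denote the interior of $X_+$ with respect to the order topology $\tau_o(X)$. Then $$\tau_o\text{-int}(X_+)=\{x\in X;\ x \text{ is net catching}\}.$$
   Context: A partially ordered vector space is a real vector space $X$ with a partial order $\leq$ such that $x\leq y$ implies $x+z\leq y+z$ and $\lambda x\leq\lambda y$ for all $z\in X$ and real $\lambda\geq 0$; $X_+=\{x\in X;\ x\geq 0\}$, and $[x,y]=\{z\in X;\ x\leq z\leq y\}$. For a net $(x_\alpha)_{\alpha\in A}$ in $X$ we write $x_\alpha\downarrow 0$ if the net is decreasing ($\alpha\leq\beta$ implies $x_\beta\leq x_\alpha$) and $\inf_{\alpha\in A} x_\alpha=0$. A set $M\subseteq X$ is net catching for $x\in X$ if for every net $(x_\alpha)_{\alpha\in A}$ in $X$ with $x_\alpha\downarrow 0$ there is $\alpha\in A$ with $[x-x_\alpha,x+x_\alpha]\subseteq M$. A set $O\subseteq X$ is order open if it is net catching for every $x\in O$. The order topology is $\tau_o(X)=\{O\subseteq X;\ O\text{ order open}\}$. An element $y\in X$ is called net catching if for every net $(x_\alpha)_{\alpha\in A}$ in $X$ with $x_\alpha\downarrow 0$ there is $\alpha\in A$ with $x_\alpha\leq y$. *)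

theory Defs
  imports "HOL-Analysis.Abstract_Topology" "HOL-Library.Lub_Glb"
begin

text \<open>
  Partially ordered vector spaces are the types of class \<^class>\<open>ordered_real_vector\<close>; the order
  need not be a lattice order.

  A directed set is a nonempty carrier \<open>A\<close> with a preorder \<open>le\<close> in which any two elements have an
  upper bound.
\<close>

definition directed_set :: "'i set \<Rightarrow> ('i \<Rightarrow> 'i \<Rightarrow> bool) \<Rightarrow> bool" where
  "directed_set A le \<longleftrightarrow>
     A \<noteq> {} \<and> reflp_on A le \<and> transp_on A le \<and>
     (\<forall>\<alpha>\<in>A. \<forall>\<beta>\<in>A. \<exists>\<gamma>\<in>A. le \<alpha> \<gamma> \<and> le \<beta> \<gamma>)"

definition net_down_zero ::
    "'i set \<Rightarrow> ('i \<Rightarrow> 'i \<Rightarrow> bool) \<Rightarrow> ('i \<Rightarrow> 'a::ordered_real_vector) \<Rightarrow> bool" where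
  "net_down_zero A le x \<longleftrightarrow>
     directed_set A le \<and>
     (\<forall>\<alpha>\<in>A. \<forall>\<beta>\<in>A. le \<alpha> \<beta> \<longrightarrow> x \<beta> \<le> x \<alpha>) \<and>
     isGlb UNIV (x ` A) 0"

text \<open>
  HOL cannot quantify over the type of the indices inside a definition. The following definitions
  therefore let the index sets range over all directed subsets of the space itself, under arbitrary
  preorders. This loses no nets: by \<open>net_catching_set_index\<close> and \<open>net_catching_index\<close> below, the
  defining property then holds for nets with indices of any type.
\<close>

definition net_catching_set :: "'a::ordered_real_vector set \<Rightarrow> 'a \<Rightarrow> bool" where
  "net_catching_set M x \<longleftrightarrow>
     (\<forall>(A :: 'a set) le z. net_down_zero A le z \<longrightarrow> (\<exists>\<alpha>\<in>A. {x - z \<alpha> .. x + z \<alpha>} \<subseteq> M))"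

definition net_catching :: "'a::ordered_real_vector \<Rightarrow> bool" where
  "net_catching y \<longleftrightarrow>
     (\<forall>(A :: 'a set) le z. net_down_zero A le z \<longrightarrow> (\<exists>\<alpha>\<in>A. z \<alpha> \<le> y))"

lemma net_down_zero_range:
  assumes "net_down_zero A le z"
  shows "net_down_zero (z ` A) (\<lambda>u v. v \<le> u) (\<lambda>u. u)"
proof -
  have mono: "z \<beta> \<le> z \<alpha>" if "\<alpha> \<in> A" "\<beta> \<in> A" "le \<alpha> \<beta>" for \<alpha> \<beta>
    using assms that by (auto simp: net_down_zero_def)
  have dir: "\<exists>\<gamma>\<in>A. le \<alpha> \<gamma> \<and> le \<beta> \<gamma>" if "\<alpha> \<in> A" "\<beta> \<in> A" for \<alpha> \<beta>
    using assms that by (auto simp: net_down_zero_def directed_set_def)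
  have "\<exists>w\<in>z ` A. w \<le> u \<and> w \<le> v" if "u \<in> z ` A" "v \<in> z ` A" for u v
    using that mono dir by (metis (no_types, opaque_lifting) image_iff)
  then have "directed_set (z ` A) (\<lambda>u v. v \<le> u)"
    using assms by (auto simp: net_down_zero_def directed_set_def reflp_on_def transp_on_def)
  then show ?thesis
    using assms by (auto simp: net_down_zero_def)
qed

lemma net_catching_set_index:
  fixes A :: "'i set" and z :: "'i \<Rightarrow> 'a::ordered_real_vector"
  assumes "net_catching_set M x" and "net_down_zero A le z"
  shows "\<exists>\<alpha>\<in>A. {x - z \<alpha> .. x + z \<alpha>} \<subseteq> M"
proof -
  have "\<exists>u\<in>z ` A. {x - u .. x + u} \<subseteq> M"
    using assms(1) net_down_zero_range[OF assms(2)] unfolding net_catching_set_def by blast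
  then show ?thesis by blast
qed

lemma net_catching_index:
  fixes A :: "'i set" and z :: "'i \<Rightarrow> 'a::ordered_real_vector"
  assumes "net_catching y" and "net_down_zero A le z"
  shows "\<exists>\<alpha>\<in>A. z \<alpha> \<le> y"
proof -
  have "\<exists>u\<in>z ` A. u \<le> y"
    using assms(1) net_down_zero_range[OF assms(2)] unfolding net_catching_def by blast
  then show ?thesis by blast
qed

definition order_open :: "'a::ordered_real_vector set \<Rightarrow> bool" where
  "order_open U \<longleftrightarrow> (\<forall>x\<in>U. net_catching_set U x)"

definition order_topology :: "'a::ordered_real_vector topology" where
  "order_topology = topology order_open"

lemma net_catching_set_mono:
  "net_catching_set M x \<Longrightarrow> M \<subseteq> N \<Longrightarrow> net_catching_set N x"
  unfolding net_catching_set_def by (meson order_trans)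

lemma net_catching_set_Int:
  fixes x :: "'a::ordered_real_vector"
  assumes "net_catching_set M x" "net_catching_set N x"
  shows "net_catching_set (M \<inter> N) x"
  unfolding net_catching_set_def
proof (intro allI impI)
  fix A :: "'a set" and le and z :: "'a \<Rightarrow> 'a"
  assume net: "net_down_zero A le z"
  obtain \<alpha> where \<alpha>: "\<alpha> \<in> A" "{x - z \<alpha> .. x + z \<alpha>} \<subseteq> M"
    using assms(1) net unfolding net_catching_set_def by blast
  obtain \<beta> where \<beta>: "\<beta> \<in> A" "{x - z \<beta> .. x + z \<beta>} \<subseteq> N"
    using assms(2) net unfolding net_catching_set_def by blast
  obtain \<gamma> where \<gamma>: "\<gamma> \<in> A" "le \<alpha> \<gamma>" "le \<beta> \<gamma>"
    using net \<alpha>(1) \<beta>(1) unfolding net_down_zero_def directed_set_def by blast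
  have le: "z \<gamma> \<le> z \<alpha>" "z \<gamma> \<le> z \<beta>"
    using net \<alpha>(1) \<beta>(1) \<gamma> unfolding net_down_zero_def by blast+
  have sub: "{x - z \<gamma> .. x + z \<gamma>} \<subseteq> {x - z \<delta> .. x + z \<delta>}" if "z \<gamma> \<le> z \<delta>" for \<delta>
    using that by (simp add: diff_left_mono)
  have "{x - z \<gamma> .. x + z \<gamma>} \<subseteq> M \<inter> N"
    using sub[OF le(1)] sub[OF le(2)] \<alpha>(2) \<beta>(2) by blast
  with \<gamma>(1) show "\<exists>\<alpha>\<in>A. {x - z \<alpha> .. x + z \<alpha>} \<subseteq> M \<inter> N" by blast
qed

lemma istopology_order_open: "istopology order_open"
  unfolding istopology_def order_open_def
  by (blast intro: net_catching_set_Int net_catching_set_mono)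

lemma openin_order_topology [simp]: "openin order_topology U \<longleftrightarrow> order_open U"
  by (simp add: order_topology_def topology_inverse'[OF istopology_order_open])

lemma topspace_order_topology [simp]: "topspace order_topology = UNIV"
proof -
  have "order_open UNIV"
    unfolding order_open_def net_catching_set_def net_down_zero_def directed_set_def by blast
  then show ?thesis
    by (metis openin_order_topology openin_subset top.extremum_uniqueI)
qed

end

theory Submission
  imports Defs
begin

text \<open>
  The net catching elements form an upward closed subset of the positive cone that is invariant
  under halving, because \<open>2 x\<^sub>\<alpha> \<down> 0\<close> whenever \<open>x\<^sub>\<alpha> \<down> 0\<close>. This set is order open: if \<open>y\<close> is net
  catching and \<open>2 x\<^sub>\<alpha> \<le> y\<close>, then every element of \<open>[y - x\<^sub>\<alpha>, y + x\<^sub>\<alpha>]\<close> dominates \<open>y/2\<close>.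
  Conversely, if \<open>[x - x\<^sub>\<alpha>, x + x\<^sub>\<alpha>]\<close> lies in the cone, then its left end point gives \<open>x\<^sub>\<alpha> \<le> x\<close>.
\<close>

lemma isGlb_UNIV_zero_iff:
  fixes S :: "'a::ordered_real_vector set"
  shows "isGlb UNIV S 0 \<longleftrightarrow> (\<forall>s\<in>S. 0 \<le> s) \<and> (\<forall>w. (\<forall>s\<in>S. w \<le> s) \<longrightarrow> w \<le> 0)"
  by (auto simp: isGlb_def greatestP_def isLb_def setge_def setle_def)

lemma net_down_zero_nonneg:
  "net_down_zero A le z \<Longrightarrow> \<alpha> \<in> A \<Longrightarrow> 0 \<le> z \<alpha>"
  by (auto simp: net_down_zero_def isGlb_UNIV_zero_iff)

text \<open>This one-point net is the test net that forces net catching elements to be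
  positive.\<close>

lemma net_down_zero_const: "net_down_zero {i} (=) (\<lambda>_. 0)"
  by (auto simp: net_down_zero_def directed_set_def isGlb_UNIV_zero_iff reflp_on_def transp_on_def)

text \<open>Division by \<open>c > 0\<close> turns a lower bound \<open>w\<close> of the scaled net
  into a lower bound of \<open>z\<close>, so the infimum stays zero.\<close>

lemma net_down_zero_scaleR:
  fixes z :: "'i \<Rightarrow> 'a::ordered_real_vector"
  assumes net: "net_down_zero A le z" and c: "0 < c"
  shows "net_down_zero A le (\<lambda>\<alpha>. c *\<^sub>R z \<alpha>)"
proof -
  have "w \<le> 0" if "\<And>\<alpha>. \<alpha> \<in> A \<Longrightarrow> w \<le> c *\<^sub>R z \<alpha>" for w
  proof -
    have "w /\<^sub>R c \<le> z \<alpha>" if "\<alpha> \<in> A" for \<alpha>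
      using \<open>\<And>\<alpha>. \<alpha> \<in> A \<Longrightarrow> w \<le> c *\<^sub>R z \<alpha>\<close>[OF that] c
      by (simp add: pos_divideR_le_eq)
    then have "w /\<^sub>R c \<le> 0"
      using net by (auto simp: net_down_zero_def isGlb_UNIV_zero_iff)
    then show "w \<le> 0"
      using c by (simp add: pos_divideR_le_eq)
  qed
  then show ?thesis
    using net c by (auto simp: net_down_zero_def isGlb_UNIV_zero_iff intro: scaleR_left_mono scaleR_nonneg_nonneg)
qed

lemma net_catching_mono: "net_catching x \<Longrightarrow> x \<le> y \<Longrightarrow> net_catching y"
  unfolding net_catching_def by (meson order_trans)

lemma net_catching_nonneg: "net_catching y \<Longrightarrow> 0 \<le> y"
  using net_catching_index[OF _ net_down_zero_const[of "()"]] by blast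

text \<open>Catching \<open>z\<close> below \<open>c *\<^sub>R y\<close> amounts to catching the net
  \<open>z\<close> scaled by \<open>inverse c\<close> below \<open>y\<close>.\<close>

lemma net_catching_scaleR:
  fixes y :: "'a::ordered_real_vector"
  assumes y: "net_catching y" and c: "0 < c"
  shows "net_catching (c *\<^sub>R y)"
  unfolding net_catching_def
proof (intro allI impI)
  fix A :: "'a set" and le and z :: "'a \<Rightarrow> 'a"
  assume "net_down_zero A le z"
  then have "net_down_zero A le (\<lambda>\<alpha>. inverse c *\<^sub>R z \<alpha>)"
    using c by (simp add: net_down_zero_scaleR)
  then obtain \<alpha> where "\<alpha> \<in> A" "z \<alpha> /\<^sub>R c \<le> y"
    using net_catching_index[OF y] by blast
  then show "\<exists>\<alpha>\<in>A. z \<alpha> \<le> c *\<^sub>R y"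
    using c by (auto simp: pos_divideR_le_eq)
qed

lemma order_open_net_catching: "order_open {y :: 'a::ordered_real_vector. net_catching y}"
  unfolding order_open_def net_catching_set_def
proof (intro ballI allI impI)
  fix y :: 'a and A :: "'a set" and le and z :: "'a \<Rightarrow> 'a"
  assume "y \<in> {y. net_catching y}" and net: "net_down_zero A le z"
  then have half: "net_catching ((1/2) *\<^sub>R y)"
    by (simp add: net_catching_scaleR)
  obtain \<alpha> where \<alpha>: "\<alpha> \<in> A" "z \<alpha> \<le> (1/2) *\<^sub>R y"
    using net_catching_index[OF half net] by blast
  \<comment> \<open>Written as a difference, \<open>y/2\<close> compares with the left end point of
    the interval, so upward closure covers the whole interval.\<close>
  have "(1/2) *\<^sub>R y = y - (1/2) *\<^sub>R y"
    using scaleR_left_diff_distrib[of 1 "1/2" y] by simp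
  also have "\<dots> \<le> y - z \<alpha>"
    using \<alpha>(2) by (rule diff_left_mono)
  finally have "{y - z \<alpha> .. y + z \<alpha>} \<subseteq> {y. net_catching y}"
    using net_catching_mono[OF half] by (auto intro: order_trans)
  with \<alpha>(1) show "\<exists>\<alpha>\<in>A. {y - z \<alpha> .. y + z \<alpha>} \<subseteq> {y. net_catching y}"
    by blast
qed

lemma net_catching_set_nonneg_imp_net_catching:
  assumes "net_catching_set {x. 0 \<le> x} x"
  shows "net_catching x"
  unfolding net_catching_def
proof (intro allI impI)
  fix A :: "'a set" and le and z :: "'a \<Rightarrow> 'a"
  assume net: "net_down_zero A le z"
  then obtain \<alpha> where \<alpha>: "\<alpha> \<in> A" "{x - z \<alpha> .. x + z \<alpha>} \<subseteq> {x. 0 \<le> x}"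
    using assms unfolding net_catching_set_def by blast
  \<comment> \<open>Positivity of \<open>z \<alpha>\<close> makes the interval nonempty, so that it
    contains its left end point.\<close>
  have "- z \<alpha> \<le> z \<alpha>"
    using net_down_zero_nonneg[OF net \<alpha>(1)] by (meson neg_le_0_iff_le order_trans)
  then have "x - z \<alpha> \<in> {x - z \<alpha> .. x + z \<alpha>}"
    by simp
  with \<alpha>(2) have "x - z \<alpha> \<in> {x. 0 \<le> x}"
    by (rule subsetD)
  then show "\<exists>\<alpha>\<in>A. z \<alpha> \<le> x"
    using \<alpha>(1) by auto
qed

theorem theorem2p6:
  shows "order_topology interior_of {x :: 'a::ordered_real_vector. 0 \<le> x} = {x. net_catching x}"
proof (rule interior_of_unique)
  show "{x :: 'a. net_catching x} \<subseteq> {x. 0 \<le> x}"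
    by (auto intro: net_catching_nonneg)
  show "openin order_topology {x :: 'a. net_catching x}"
    by (simp add: order_open_net_catching)
  \<comment> \<open>An open \<open>U\<close> inside the cone is net catching for each of its points;
    by monotonicity so is the cone, and the converse direction applies pointwise.\<close>
  show "U \<subseteq> {x. net_catching x}"
    if "U \<subseteq> {x. 0 \<le> x}" "openin order_topology U" for U :: "'a set"
    using that by (auto simp: order_open_def
        intro: net_catching_set_nonneg_imp_net_catching net_catching_set_mono)
qed

end
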